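(* For every integer $v\ge0$ and every symmetric polynomial $P[X_n]$ in $x_1,\dots,x_n$ with coefficients in $\mathbb{Q}(q)$, $$R_vP[X_n]=\frac{\chi(v=0)}{1-q}P[X_n]+\frac{q^{n+v}}{q-1}\,P\big[X_n-(1-q)/z\big]\,\Omega\big[(1-1/q)zX_n\big]\Big|_{z^v}.$$
   Context: $X_n=x_1+\cdots+x_n$; $\Delta[X_n]=\prod_{1\le i<j\le n}(x_i-x_j)$; $T^q_{x_i}$ is the substitution $x_i\mapsto qx_i$; $R_vP=\frac{1}{\Delta[X_n]}\sum_{i=1}^nT^q_{x_i}(x_i^v\Delta[X_n]P)$. Plethystic notation: $P[X_n-(1-q)/z]$ is obtained by writing $P$ in power sums and substituting $p_k\mapsto p_k(x_1,\dots,x_n)-(1-q^k)z^{-k}$; $\Omega[(1-1/q)zX_n]=\prod_{i=1}^n\frac{1-q^{-1}zx_i}{1-zx_i}$ expanded in $z$; $|_{z^v}$ is the coefficient of $z^v$. $\chi(v=0)$ is $1$ if $v=0$ and $0$ otherwise. *)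

theory Defs
  imports
    "HOL-Library.Poly_Mapping"
    "HOL-Combinatorics.Permutations"
    "HOL-Computational_Algebra.Computational_Algebra"
begin

text \<open>
  A monomial is a finitely supported exponent vector, and a polynomial is a finitely supported
  family of coefficients indexed by monomials; multiplication is the convolution product of
  \<^theory>\<open>HOL-Library.Poly_Mapping\<close>. Infinitely many variables are available; a polynomial in
  $x_1,\dots,x_n$ is one whose variables lie in \<open>{1..n}\<close>.
\<close>

type_synonym 'a mpoly = "(nat \<Rightarrow>\<^sub>0 nat) \<Rightarrow>\<^sub>0 'a"

definition Const :: "'a::zero \<Rightarrow> 'a mpoly" where
  "Const c = Poly_Mapping.single 0 c"

definition Var :: "nat \<Rightarrow> 'a::zero_neq_one mpoly" where
  "Var i = Poly_Mapping.single (Poly_Mapping.single i 1) 1"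

definition vars :: "'a::zero mpoly \<Rightarrow> nat set" where
  "vars p = (\<Union>m\<in>Poly_Mapping.keys p. Poly_Mapping.keys m)"

text \<open>
  Substitution of \<open>f i\<close> for the \<open>i\<close>-th variable, in a ring receiving the coefficients through \<open>c\<close>.
\<close>

definition ev :: "('a::zero \<Rightarrow> 'b::comm_ring_1) \<Rightarrow> (nat \<Rightarrow> 'b) \<Rightarrow> 'a mpoly \<Rightarrow> 'b" where
  "ev c f p = (\<Sum>m\<in>Poly_Mapping.keys p.
     c (Poly_Mapping.lookup p m) * (\<Prod>i\<in>Poly_Mapping.keys m. f i ^ Poly_Mapping.lookup m i))"

definition symmetric_poly :: "nat \<Rightarrow> 'a::comm_ring_1 mpoly \<Rightarrow> bool" where
  "symmetric_poly n P \<longleftrightarrow>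
     vars P \<subseteq> {1..n} \<and> (\<forall>\<sigma>. \<sigma> permutes {1..n} \<longrightarrow> ev Const (\<lambda>i. Var (\<sigma> i)) P = P)"

text \<open>
  The field $\mathbb{Q}(q)$, the polynomial ring over it, and the field $\mathbb{Q}(q)(x_1,x_2,\dots)$.
\<close>

type_synonym ratq = "rat poly fract"
type_synonym qpoly = "ratq mpoly"
type_synonym qfrac = "qpoly fract"

definition qq :: ratq where
  "qq = to_fract [:0, 1:]"

definition scal :: "ratq \<Rightarrow> qfrac" where
  "scal a = to_fract (Const a)"

definition vandermonde :: "nat \<Rightarrow> qpoly" where
  "vandermonde n = (\<Prod>(i, j)\<in>{(i, j). 1 \<le> i \<and> i < j \<and> j \<le> n}. Var i - Var j)"

definition Tq :: "nat \<Rightarrow> qpoly \<Rightarrow> qpoly" where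
  "Tq i P = ev Const (\<lambda>j. if j = i then Const qq * Var i else Var j) P"

definition R :: "nat \<Rightarrow> nat \<Rightarrow> qpoly \<Rightarrow> qfrac" where
  "R n v P = to_fract (\<Sum>i=1..n. Tq i (Var i ^ v * vandermonde n * P)) / to_fract (vandermonde n)"

definition power_sum :: "nat \<Rightarrow> nat \<Rightarrow> qpoly" where
  "power_sum n k = (\<Sum>i=1..n. Var i ^ k)"

text \<open>
  \<open>F\<close>, whose \<open>k\<close>-th variable stands for $p_k$ with $k\ge1$, writes \<open>P\<close> in power sums. No bound is
  put on \<open>k\<close>, so an \<open>F\<close> for \<open>P\<close> is not unique (for \<open>n = 1\<close>, $p_1^2 = p_2$).
\<close>

definition power_sum_expression :: "nat \<Rightarrow> qpoly \<Rightarrow> qpoly \<Rightarrow> bool" where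
  "power_sum_expression n F P \<longleftrightarrow> vars F \<subseteq> {1..} \<and> ev Const (power_sum n) F = P"

text \<open>
  $P[X_n-(1-q)/z]$ for \<open>P\<close> written in power sums as \<open>F\<close>; the variable \<open>fls_X\<close> of the formal Laurent
  series plays the role of $z$.
\<close>

definition pleth :: "nat \<Rightarrow> qpoly \<Rightarrow> qfrac fls" where
  "pleth n F = ev (\<lambda>a. fls_const (scal a))
     (\<lambda>k. fls_const (to_fract (power_sum n k)) - fls_const (scal (1 - qq ^ k)) * fls_X_inv ^ k) F"

text \<open>
  Division in the field of formal Laurent series in $z$ is expansion at $z=0$.
\<close>

definition Omega :: "nat \<Rightarrow> qfrac fls" where
  "Omega n = (\<Prod>i=1..n. (1 - fls_const (scal (inverse qq) * to_fract (Var i)) * fls_X) /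
                          (1 - fls_const (to_fract (Var i)) * fls_X))"

end

theory Submission
  imports Defs
begin

text \<open>
  Existence: up to the factor $n!$, a symmetric polynomial is the sum of its images under all
  permutations, hence a combination of the sums of $\prod_i x_{f(i)}^{a_i}$ over injective $f$; these
  are obtained from the power sums by adjoining one index at a time, since multiplying such a sum by
  $p_b$ either adds a new index with exponent $b$ or raises one of the exponents by $b$.

  Identity: $T^q_{x_i}P = P[X_n-(1-q)/z]$ at $z = 1/x_i$, and
  $T^q_{x_i}\Delta = A_i\Delta$ with $A_i=\prod_{j\ne i}(qx_i-x_j)/(x_i-x_j)$. Hence
  $R_vP = q^v\sum_m c_m\sum_i A_i x_i^{v+m}$ if $P[X_n-(1-q)/z]=\sum_m c_mz^{-m}$. On the other hand,
  Lagrange interpolation yields the partial fractions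
  $q^n\,\Omega[(1-1/q)zX_n] = 1+(q-1)\sum_i A_i/(1-zx_i)$, so the inner sum is a coefficient of
  \<open>Omega\<close>, up to the constant 1. That constant only meets $v = m = 0$, where $c_0 = P$.
\<close>

section \<open>Substitution is a ring homomorphism\<close>

text \<open>One predicate covers every coefficient embedding and substitution in play, so that sums,
  products and powers pass through all of them by the same lemmas.\<close>

definition ring_map :: "('a::comm_ring_1 \<Rightarrow> 'b::comm_ring_1) \<Rightarrow> bool" where
  "ring_map h \<longleftrightarrow> h 0 = 0 \<and> h 1 = 1 \<and> (\<forall>x y. h (x + y) = h x + h y) \<and> (\<forall>x y. h (x * y) = h x * h y)"

lemma ring_mapI:
  assumes "h 0 = 0" "h 1 = 1" "\<And>x y. h (x + y) = h x + h y" "\<And>x y. h (x * y) = h x * h y"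
  shows "ring_map h"
  using assms by (simp add: ring_map_def)

lemma
  assumes "ring_map h"
  shows ring_map_0: "h 0 = 0" and ring_map_1: "h 1 = 1"
    and ring_map_add: "h (x + y) = h x + h y" and ring_map_mult: "h (x * y) = h x * h y"
  using assms by (simp_all add: ring_map_def)

lemma ring_map_minus:
  assumes "ring_map h"
  shows "h (- x) = - h x"
  using ring_map_add[OF assms, of x "- x"] ring_map_0[OF assms] by (simp add: minus_unique)

lemma ring_map_diff:
  assumes "ring_map h"
  shows "h (x - y) = h x - h y"
  using ring_map_add[OF assms, of x "- y"] ring_map_minus[OF assms] by simp

lemma ring_map_sum:
  assumes "ring_map h"
  shows "h (sum f A) = (\<Sum>x\<in>A. h (f x))"
  by (induction A rule: infinite_finite_induct) (simp_all add: ring_map_0[OF assms] ring_map_add[OF assms])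

lemma ring_map_prod:
  assumes "ring_map h"
  shows "h (prod f A) = (\<Prod>x\<in>A. h (f x))"
  by (induction A rule: infinite_finite_induct) (simp_all add: ring_map_1[OF assms] ring_map_mult[OF assms])

lemma ring_map_power:
  assumes "ring_map h"
  shows "h (x ^ n) = h x ^ n"
  by (induction n) (simp_all add: ring_map_1[OF assms] ring_map_mult[OF assms])

lemma ring_map_comp:
  assumes "ring_map g" "ring_map h"
  shows "ring_map (\<lambda>x. g (h x))"
  using assms by (simp add: ring_map_def)

lemma ring_map_to_fract: "ring_map to_fract"
  by (rule ring_mapI) simp_all

lemma ring_map_Const: "ring_map Const"
  by (rule ring_mapI) (simp_all add: Const_def single_add mult_single)

lemma ring_map_scal: "ring_map scal"
  unfolding scal_def by (intro ring_map_comp[OF ring_map_to_fract] ring_map_Const)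

lemma scal_eq_0_iff: "scal a = 0 \<longleftrightarrow> a = 0"
  by (simp add: scal_def Const_def) (metis single_zero inj_single injD)

lemma scal_divide: "scal (a / b) = scal a / scal b"
\<comment> \<open>For \<open>b = 0\<close> both sides are 0, since division by zero yields 0 in
  either field.\<close>
proof (cases "b = 0")
  case False
  then have "scal (a / b) * scal b = scal a"
    by (simp flip: ring_map_mult[OF ring_map_scal])
  with False show ?thesis by (simp add: scal_eq_0_iff nonzero_eq_divide_eq)
qed (simp add: ring_map_0[OF ring_map_scal])

lemma ring_map_fls_const: "ring_map fls_const"
  by (rule ring_mapI) (simp_all add: fls_const_mult_const fls_plus_const)

definition monom_ev :: "(nat \<Rightarrow> 'b::comm_ring_1) \<Rightarrow> (nat \<Rightarrow>\<^sub>0 nat) \<Rightarrow> 'b" where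
  "monom_ev f m = (\<Prod>i\<in>Poly_Mapping.keys m. f i ^ Poly_Mapping.lookup m i)"

lemma ev_monom_ev:
  "ev c f p = (\<Sum>m\<in>Poly_Mapping.keys p. c (Poly_Mapping.lookup p m) * monom_ev f m)"
  by (simp add: ev_def monom_ev_def)

text \<open>Indices outside the support contribute factors with exponent 0; two monomials can thus
  be evaluated over a common index set.\<close>

lemma monom_ev_superset:
  assumes "finite A" "Poly_Mapping.keys m \<subseteq> A"
  shows "monom_ev f m = (\<Prod>i\<in>A. f i ^ Poly_Mapping.lookup m i)"
  unfolding monom_ev_def using assms by (intro prod.mono_neutral_left) (auto simp: in_keys_iff)

lemma monom_ev_add: "monom_ev f (m + m') = monom_ev f m * monom_ev f m'"
proof -
  let ?A = "Poly_Mapping.keys m \<union> Poly_Mapping.keys m'"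
  have "monom_ev f (m + m') = (\<Prod>i\<in>?A. f i ^ Poly_Mapping.lookup (m + m') i)"
    using Poly_Mapping.keys_add[of m m'] by (intro monom_ev_superset) auto
  also have "\<dots> = (\<Prod>i\<in>?A. f i ^ Poly_Mapping.lookup m i) * (\<Prod>i\<in>?A. f i ^ Poly_Mapping.lookup m' i)"
    by (simp add: lookup_add power_add prod.distrib)
  also have "\<dots> = monom_ev f m * monom_ev f m'"
    by (simp add: monom_ev_superset[of ?A])
  finally show ?thesis .
qed

text \<open>Terms may cancel in \<open>p + q\<close>, so its keys need not be the union of the keys;
  \<open>c 0 = 0\<close> makes the missing terms harmless.\<close>

lemma ev_add:
  assumes "ring_map c"
  shows "ev c f (p + q) = ev c f p + ev c f q"
proof -
  note [simp] = ring_map_0[OF assms] ring_map_add[OF assms]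
  show ?thesis
    unfolding ev_monom_ev by (intro setsum_keys_plus_distrib) (simp_all add: distrib_right)
qed

lemma ev_single:
  assumes "ring_map c"
  shows "ev c f (Poly_Mapping.single m a) = c a * monom_ev f m"
  using ring_map_0[OF assms] by (cases "a = 0") (simp_all add: ev_monom_ev)

lemma ev_0: "ev c f 0 = 0"
  by (simp add: ev_def)

lemma ev_sum:
  assumes "ring_map c"
  shows "ev c f (sum g A) = (\<Sum>x\<in>A. ev c f (g x))"
  by (induction A rule: infinite_finite_induct) (simp_all add: ev_0 ev_add[OF assms])

lemma poly_mapping_eq_sum_single:
  "p = (\<Sum>m\<in>Poly_Mapping.keys p. Poly_Mapping.single m (Poly_Mapping.lookup p m))"
  by (rule poly_mapping_eqI) (simp add: lookup_sum lookup_single when_def in_keys_iff)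

text \<open>For products, biadditivity reduces the claim to single terms, where it is
  \<open>monom_ev_add\<close>.\<close>

lemma ring_map_ev:
  assumes "ring_map c"
  shows "ring_map (ev c f)"
proof (rule ring_mapI)
  show "ev c f 1 = 1"
    using ring_map_1[OF assms] by (simp flip: single_one add: ev_single[OF assms] monom_ev_def)
  fix p q
  let ?s = "\<lambda>p m. Poly_Mapping.single m (Poly_Mapping.lookup p m)"
  have "ev c f (p * q) = ev c f ((\<Sum>m\<in>Poly_Mapping.keys p. ?s p m) * (\<Sum>m\<in>Poly_Mapping.keys q. ?s q m))"
    by (simp flip: poly_mapping_eq_sum_single)
  also have "\<dots> = (\<Sum>m\<in>Poly_Mapping.keys p. \<Sum>m'\<in>Poly_Mapping.keys q. ev c f (?s p m * ?s q m'))"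
    by (simp add: sum_product ev_sum[OF assms])
  also have "\<dots> = ev c f p * ev c f q"
    by (simp add: mult_single ev_single[OF assms] monom_ev_add ring_map_mult[OF assms]
        ev_monom_ev[of c f p] ev_monom_ev[of c f q] sum_product mult_ac)
  finally show "ev c f (p * q) = ev c f p * ev c f q" .
qed (simp_all add: ev_0 ev_add[OF assms])

lemma ring_map_comp_ev:
  assumes "ring_map h"
  shows "h (ev c f p) = ev (\<lambda>a. h (c a)) (\<lambda>i. h (f i)) p"
  unfolding ev_def
  by (simp add: ring_map_sum[OF assms] ring_map_mult[OF assms] ring_map_prod[OF assms]
      ring_map_power[OF assms])

lemma ev_cong:
  assumes "\<And>a. c a = c' a" "\<And>i. i \<in> vars p \<Longrightarrow> f i = f' i"
  shows "ev c f p = ev c' f' p"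
proof -
  have "f i = f' i" if "m \<in> Poly_Mapping.keys p" "i \<in> Poly_Mapping.keys m" for m i
    using assms(2) that by (auto simp: vars_def)
  then show ?thesis
    by (simp add: ev_def assms(1))
qed

lemma ev_Const: "ring_map c \<Longrightarrow> ev c f (Const a) = c a"
  by (simp add: Const_def ev_single monom_ev_def)

lemma ev_Var: "ring_map c \<Longrightarrow> ev c f (Var i) = f i"
  by (simp add: Var_def ev_single monom_ev_def ring_map_1)

lemma ring_map_Tq: "ring_map (Tq i)"
  unfolding Tq_def[abs_def] by (intro ring_map_ev ring_map_Const)

lemma Tq_Const: "Tq i (Const a) = Const a"
  by (simp add: Tq_def ev_Const ring_map_Const)

lemma Tq_Var: "Tq i (Var j) = (if j = i then Const qq * Var i else Var j)"
  by (simp add: Tq_def ev_Var ring_map_Const)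

section \<open>Power sums generate the symmetric polynomials\<close>

lemma vars_Const: "vars (Const a) = {}"
  by (auto simp: vars_def Const_def split: if_splits)

lemma vars_Var: "vars (Var i :: 'a::zero_neq_one mpoly) = {i}"
  by (simp add: vars_def Var_def)

lemma vars_add: "vars (p + q) \<subseteq> vars p \<union> vars q"
  using Poly_Mapping.keys_add[of p q] by (auto simp: vars_def)

lemma vars_mult: "vars (p * q) \<subseteq> vars p \<union> vars q"
proof
  fix i assume "i \<in> vars (p * q)"
  then obtain m where m: "m \<in> Poly_Mapping.keys (p * q)" "i \<in> Poly_Mapping.keys m"
    by (auto simp: vars_def)
  from m(1) obtain a b where ab: "m = a + b" "a \<in> Poly_Mapping.keys p" "b \<in> Poly_Mapping.keys q"
    using keys_mult[of p q] by blast
  with m(2) Poly_Mapping.keys_add[of a b] show "i \<in> vars p \<union> vars q"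
    by (auto simp: vars_def)
qed

text \<open>The algebra over the coefficient field generated by the power sums of positive
  index.\<close>

definition power_sum_alg :: "nat \<Rightarrow> qpoly set" where
  "power_sum_alg n = {P. \<exists>F. power_sum_expression n F P}"

lemma power_sum_alg_Const: "Const a \<in> power_sum_alg n"
  unfolding power_sum_alg_def power_sum_expression_def
  by (intro CollectI exI[of _ "Const a"]) (simp add: ev_Const ring_map_Const vars_Const)

lemma power_sum_alg_add:
  assumes "P \<in> power_sum_alg n" "Q \<in> power_sum_alg n"
  shows "P + Q \<in> power_sum_alg n"
proof -
  from assms obtain F G where "power_sum_expression n F P" "power_sum_expression n G Q"
    by (auto simp: power_sum_alg_def)
  then have "power_sum_expression n (F + G) (P + Q)"
    using vars_add[of F G] by (auto simp: power_sum_expression_def ev_add ring_map_Const)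
  then show ?thesis by (auto simp: power_sum_alg_def)
qed

lemma power_sum_alg_mult:
  assumes "P \<in> power_sum_alg n" "Q \<in> power_sum_alg n"
  shows "P * Q \<in> power_sum_alg n"
proof -
  from assms obtain F G where "power_sum_expression n F P" "power_sum_expression n G Q"
    by (auto simp: power_sum_alg_def)
  then have "power_sum_expression n (F * G) (P * Q)"
    using vars_mult[of F G]
    by (auto simp: power_sum_expression_def ring_map_mult[OF ring_map_ev] ring_map_Const)
  then show ?thesis by (auto simp: power_sum_alg_def)
qed

lemma power_sum_alg_sum: "(\<And>x. x \<in> A \<Longrightarrow> f x \<in> power_sum_alg n) \<Longrightarrow> sum f A \<in> power_sum_alg n"
proof (induction A rule: infinite_finite_induct)
  case (insert x A)
  then show ?case by (simp add: power_sum_alg_add)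
qed (use power_sum_alg_Const[of 0 n] in \<open>simp_all add: ring_map_0[OF ring_map_Const]\<close>)

lemma power_sum_alg_diff:
  assumes "P \<in> power_sum_alg n" "Q \<in> power_sum_alg n"
  shows "P - Q \<in> power_sum_alg n"
proof -
  have "P + Const (- 1) * Q \<in> power_sum_alg n"
    using assms by (intro power_sum_alg_add power_sum_alg_mult power_sum_alg_Const)
  then show ?thesis
    by (simp add: ring_map_minus[OF ring_map_Const] ring_map_1[OF ring_map_Const])
qed

text \<open>Exponents in a monomial may be 0, so index 0 has to be covered although \<open>F\<close>
  has no variable for it: that power sum is the constant \<open>n\<close>.\<close>

lemma power_sum_alg_power_sum: "power_sum n k \<in> power_sum_alg n"
proof (cases "k = 0")
  case True
  have "of_nat n = Const (of_nat n :: ratq)"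
    by (induction n) (simp_all add: ring_map_0[OF ring_map_Const] ring_map_1[OF ring_map_Const]
        ring_map_add[OF ring_map_Const])
  with True show ?thesis
    using power_sum_alg_Const[of "of_nat n" n] by (simp add: power_sum_def)
next
  case False
  then have "power_sum_expression n (Var k) (power_sum n k)"
    by (simp add: power_sum_expression_def ev_Var ring_map_Const vars_Var)
  then show ?thesis by (auto simp: power_sum_alg_def)
qed

section \<open>Sums of monomials over injective index maps\<close>

definition inj_funs :: "nat \<Rightarrow> 'b set \<Rightarrow> ('b \<Rightarrow> nat) set" where
  "inj_funs n A = {f \<in> A \<rightarrow>\<^sub>E {1..n}. inj_on f A}"

text \<open>For finite \<open>A\<close> this is an augmented monomial symmetric polynomial, an
  integer multiple of the monomial symmetric polynomial with exponents \<open>a\<close>.\<close>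

definition inj_monom_sum :: "nat \<Rightarrow> 'b set \<Rightarrow> ('b \<Rightarrow> nat) \<Rightarrow> qpoly" where
  "inj_monom_sum n A a = (\<Sum>f\<in>inj_funs n A. \<Prod>i\<in>A. Var (f i) ^ a i)"

lemma finite_inj_funs: "finite A \<Longrightarrow> finite (inj_funs n A)"
  unfolding inj_funs_def by (intro finite_subset[OF _ finite_PiE[of A "\<lambda>_. {1..n}"]]) auto

text \<open>An injection on \<open>insert b A\<close> is an injection on \<open>A\<close> together
  with a value at \<open>b\<close> outside its image.\<close>

lemma inj_monom_sum_insert:
  assumes "finite A" "b \<notin> A"
  shows "inj_monom_sum n (insert b A) a
    = (\<Sum>f\<in>inj_funs n A. \<Sum>y\<in>{1..n} - f ` A. Var y ^ a b * (\<Prod>i\<in>A. Var (f i) ^ a i))"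
proof -
  have "inj_monom_sum n (insert b A) a
      = (\<Sum>(f, y)\<in>(SIGMA f:inj_funs n A. {1..n} - f ` A). Var y ^ a b * (\<Prod>i\<in>A. Var (f i) ^ a i))"
    unfolding inj_monom_sum_def
  \<comment> \<open>Members of \<open>inj_funs\<close> are \<open>undefined\<close> off their
    domain, so passing to \<open>A\<close> has to reset the value at \<open>b\<close>.\<close>
  proof (rule sum.reindex_bij_witness[where j = "\<lambda>g. (g(b := undefined), g b)" and i = "\<lambda>(f, y). f(b := y)"])
    fix g assume g: "g \<in> inj_funs n (insert b A)"
    show "(\<lambda>(f, y). f(b := y)) (g(b := undefined), g b) = g" by simp
    show "(g(b := undefined), g b) \<in> (SIGMA f:inj_funs n A. {1..n} - f ` A)"
      using g assms by (auto simp: inj_funs_def PiE_def extensional_def inj_on_def)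
    have "(\<Prod>i\<in>A. Var ((g(b := undefined)) i) ^ a i) = (\<Prod>i\<in>A. Var (g i) ^ a i :: qpoly)"
      using assms by (intro prod.cong) auto
    then show "(case (g(b := undefined), g b) of (f, y) \<Rightarrow> Var y ^ a b * (\<Prod>i\<in>A. Var (f i) ^ a i))
        = (\<Prod>i\<in>insert b A. Var (g i) ^ a i :: qpoly)"
      using assms by simp
  next
    fix fy assume fy: "fy \<in> (SIGMA f:inj_funs n A. {1..n} - f ` A)"
    obtain f y where [simp]: "fy = (f, y)" by force
    have "f b = undefined" using fy assms by (auto simp: inj_funs_def PiE_def extensional_def)
    then show "((case fy of (f, y) \<Rightarrow> f(b := y))(b := undefined), (case fy of (f, y) \<Rightarrow> f(b := y)) b) = fy"
      by auto
    show "(case fy of (f, y) \<Rightarrow> f(b := y)) \<in> inj_funs n (insert b A)"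
      using fy assms by (auto simp: inj_funs_def PiE_def extensional_def inj_on_def Pi_def)
  qed
  also have "\<dots> = (\<Sum>f\<in>inj_funs n A. \<Sum>y\<in>{1..n} - f ` A. Var y ^ a b * (\<Prod>i\<in>A. Var (f i) ^ a i))"
    using assms by (subst sum.Sigma) (auto simp: finite_inj_funs)
  finally show ?thesis .
qed

text \<open>Summing over all \<open>y\<close> and removing the collisions \<open>y = f c\<close>
  gives a recursion on \<open>A\<close>. A collision adds \<open>a b\<close> to the exponent at
  \<open>c\<close>, so the induction must leave \<open>a\<close> arbitrary.\<close>

lemma inj_monom_sum_in_power_sum_alg:
  "finite A \<Longrightarrow> inj_monom_sum n A a \<in> power_sum_alg n"
proof (induction A arbitrary: a rule: finite_induct)
  case empty
  have "inj_monom_sum n {} a = Const 1"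
    by (simp add: inj_monom_sum_def inj_funs_def ring_map_1[OF ring_map_Const])
  then show ?case by (simp add: power_sum_alg_Const)
next
  case (insert b A)
  let ?M = "\<lambda>f. \<Prod>i\<in>A. Var (f i) ^ a i :: qpoly"
  have "(\<Sum>y\<in>{1..n} - f ` A. Var y ^ a b * ?M f)
      = power_sum n (a b) * ?M f - (\<Sum>c\<in>A. \<Prod>i\<in>A. Var (f i) ^ (a(c := a c + a b)) i)"
    if f: "f \<in> inj_funs n A" for f
  proof -
    have "f ` A \<subseteq> {1..n}" "inj_on f A" using f by (auto simp: inj_funs_def)
    then have "(\<Sum>y\<in>{1..n} - f ` A. Var y ^ a b * ?M f)
        = power_sum n (a b) * ?M f - (\<Sum>c\<in>A. Var (f c) ^ a b * ?M f)"
      by (simp add: sum_diff sum.reindex power_sum_def sum_distrib_right)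
    also have "(\<Sum>c\<in>A. Var (f c) ^ a b * ?M f) = (\<Sum>c\<in>A. \<Prod>i\<in>A. Var (f i) ^ (a(c := a c + a b)) i)"
    proof (rule sum.cong)
      fix c assume c: "c \<in> A"
      have "(\<Prod>i\<in>A - {c}. Var (f i) ^ (a(c := a c + a b)) i) = (\<Prod>i\<in>A - {c}. Var (f i) ^ a i :: qpoly)"
        by (intro prod.cong) auto
      then show "Var (f c) ^ a b * ?M f = (\<Prod>i\<in>A. Var (f i) ^ (a(c := a c + a b)) i)"
        using insert.hyps(1) c by (simp add: prod.remove[of A c] power_add mult_ac)
    qed simp
    finally show ?thesis .
  qed
  then have "inj_monom_sum n (insert b A) a
      = power_sum n (a b) * inj_monom_sum n A a - (\<Sum>c\<in>A. inj_monom_sum n A (a(c := a c + a b)))"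
    unfolding inj_monom_sum_insert[OF insert.hyps]
    by (simp add: sum_subtractf inj_monom_sum_def sum_distrib_left sum.swap[of _ A "inj_funs n A"])
  then show ?case
    by (simp only:) (intro power_sum_alg_diff power_sum_alg_mult power_sum_alg_sum
        power_sum_alg_power_sum insert.IH)
qed

text \<open>Injective self-maps of a finite set are bijective; only the convention off
  \<open>{1..n}\<close> differs, identity against \<open>undefined\<close>.\<close>

lemma permutes_sum_eq_inj_monom_sum:
  "(\<Sum>\<sigma> | \<sigma> permutes {1..n}. \<Prod>i\<in>{1..n}. Var (\<sigma> i) ^ a i) = inj_monom_sum n {1..n} a"
  unfolding inj_monom_sum_def
proof (rule sum.reindex_bij_witness[where j = "\<lambda>\<sigma>. restrict \<sigma> {1..n}"
      and i = "\<lambda>f x. if x \<in> {1..n} then f x else x"])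
  fix \<sigma> assume "\<sigma> \<in> {\<sigma>. \<sigma> permutes {1..n}}"
  then have \<sigma>: "\<sigma> permutes {1..n}" by simp
  show "(\<lambda>x. if x \<in> {1..n} then restrict \<sigma> {1..n} x else x) = \<sigma>"
    using \<sigma> by (auto simp: permutes_def)
  show "restrict \<sigma> {1..n} \<in> inj_funs n {1..n}"
    using permutes_in_image[OF \<sigma>] permutes_inj_on[OF \<sigma>] by (auto simp: inj_funs_def inj_on_restrict_eq)
  show "(\<Prod>i\<in>{1..n}. Var (restrict \<sigma> {1..n} i) ^ a i) = (\<Prod>i\<in>{1..n}. Var (\<sigma> i) ^ a i)"
    by (intro prod.cong) auto
next
  fix f assume f: "f \<in> inj_funs n {1..n}"
  let ?g = "\<lambda>x. if x \<in> {1..n} then f x else x"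
  show "restrict ?g {1..n} = f"
    using f by (auto simp: inj_funs_def PiE_def extensional_def restrict_def)
  have "inj_on f {1..n}" "f ` {1..n} \<subseteq> {1..n}" using f by (auto simp: inj_funs_def)
  then have "bij_betw f {1..n} {1..n}"
    by (simp add: bij_betw_def endo_inj_surj)
  then have "bij_betw ?g {1..n} {1..n}" by (rule bij_betw_cong[THEN iffD1, rotated]) simp
  then show "?g \<in> {\<sigma>. \<sigma> permutes {1..n}}"
    by (auto intro!: bij_imp_permutes)
qed

lemma symmetric_poly_power_sum_expression:
  assumes "symmetric_poly n P"
  shows "\<exists>F. power_sum_expression n F P"
proof -
  \<comment> \<open>Characteristic 0 allows the division by \<open>n!\<close> at the end.\<close>
  have fact0: "(fact n :: ratq) \<noteq> 0" by simp
  have *: "monom_ev (\<lambda>i. Var (\<sigma> i)) m = (\<Prod>i\<in>{1..n}. Var (\<sigma> i) ^ Poly_Mapping.lookup m i)"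
    if "m \<in> Poly_Mapping.keys P" for m and \<sigma> :: "nat \<Rightarrow> nat"
    using assms that by (intro monom_ev_superset) (auto simp: symmetric_poly_def vars_def)
  have "of_nat (fact n) * P = (\<Sum>\<sigma> | \<sigma> permutes {1..n}. P)"
    by (simp add: card_permutations[of _ n])
  also have "\<dots> = (\<Sum>\<sigma> | \<sigma> permutes {1..n}. ev Const (\<lambda>i. Var (\<sigma> i)) P)"
    using assms by (intro sum.cong) (auto simp: symmetric_poly_def)
  also have "\<dots> = (\<Sum>m\<in>Poly_Mapping.keys P. \<Sum>\<sigma> | \<sigma> permutes {1..n}.
      Const (Poly_Mapping.lookup P m) * (\<Prod>i\<in>{1..n}. Var (\<sigma> i) ^ Poly_Mapping.lookup m i))"
    by (subst sum.swap) (simp add: ev_monom_ev *)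
  also have "\<dots> = (\<Sum>m\<in>Poly_Mapping.keys P. Const (Poly_Mapping.lookup P m) *
      inj_monom_sum n {1..n} (Poly_Mapping.lookup m))"
    by (simp only: permutes_sum_eq_inj_monom_sum flip: sum_distrib_left)
  finally have "of_nat (fact n) * P \<in> power_sum_alg n"
    by (simp only:) (intro power_sum_alg_sum power_sum_alg_mult power_sum_alg_Const
        inj_monom_sum_in_power_sum_alg finite_atLeastAtMost)
  then have "Const (1 / of_nat (fact n)) * (of_nat (fact n) * P) \<in> power_sum_alg n"
    by (intro power_sum_alg_mult[OF power_sum_alg_Const])
  also have "of_nat (fact n) = Const (of_nat (fact n) :: ratq)"
    by (simp add: Const_def del: of_nat_fact)
  also have "Const (1 / of_nat (fact n)) * (Const (of_nat (fact n)) * P) = P"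
    using fact0 by (simp add: ring_map_1[OF ring_map_Const]
        flip: mult.assoc ring_map_mult[OF ring_map_Const])
  finally show ?thesis by (simp add: power_sum_alg_def)
qed

section \<open>The factor by which the shift operator changes the Vandermonde product\<close>

abbreviation xvar :: "nat \<Rightarrow> qfrac" where
  "xvar i \<equiv> to_fract (Var i)"

text \<open>The \<open>A_i\<close> of the overview; these are the coefficients of the first
  Macdonald operator with its parameter \<open>t\<close> set to \<open>q\<close>.\<close>

definition shift_factor :: "nat \<Rightarrow> nat \<Rightarrow> qfrac" where
  "shift_factor n i = (\<Prod>j\<in>{1..n} - {i}. (scal qq * xvar i - xvar j) / (xvar i - xvar j))"

lemma Var_eq_iff: "(Var i :: 'a::zero_neq_one mpoly) = Var j \<longleftrightarrow> i = j"
proof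
  assume "(Var i :: 'a mpoly) = Var j"
  then have "vars (Var i :: 'a mpoly) = vars (Var j :: 'a mpoly)" by simp
  then show "i = j" by (simp add: vars_Var)
qed simp

lemma Var_nonzero: "(Var i :: 'a::zero_neq_one mpoly) \<noteq> 0"
  using vars_Var[of i, where 'a = 'a] by (auto simp: vars_def)

lemma qq_nonzero: "qq \<noteq> 0" and qq_neq_1: "qq \<noteq> 1"
proof -
  show "qq \<noteq> 0" by (simp add: qq_def)
  have "([:0, 1:] :: rat poly) \<noteq> 1" by (simp add: one_pCons)
  then have "to_fract [:0, 1 :: rat:] \<noteq> to_fract 1" unfolding to_fract_eq_iff .
  then show "qq \<noteq> 1" by (simp add: qq_def)
qed

lemma finite_vandermonde_pairs: "finite {(i, j). 1 \<le> i \<and> i < j \<and> j \<le> (n::nat)}"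
  by (rule finite_subset[of _ "{1..n} \<times> {1..n}"]) auto

lemma vandermonde_nonzero: "vandermonde n \<noteq> 0"
  unfolding vandermonde_def prod_zero_iff[OF finite_vandermonde_pairs] by (auto simp: Var_eq_iff)

text \<open>Only the factors containing \<open>x_i\<close> change. For \<open>j < i\<close>
  numerator and denominator both have the opposite sign to those in \<open>shift_factor\<close>,
  which leaves the quotient the same.\<close>

lemma Tq_vandermonde:
  assumes "i \<in> {1..n}"
  shows "to_fract (Tq i (vandermonde n)) = shift_factor n i * to_fract (vandermonde n)"
proof -
  let ?S = "{(a, b). 1 \<le> a \<and> a < b \<and> b \<le> n}"
  \<comment> \<open>The increasing pair formed from \<open>i\<close> and \<open>j\<close>; for
    \<open>j\<close> other than \<open>i\<close> these pairs list the factors in which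
    \<open>x_i\<close> occurs.\<close>
  let ?pair = "\<lambda>j. (min i j, max i j)"
  \<comment> \<open>The ratio by which the shift changes a single factor; it is 1 on pairs in
    \<open>?S\<close> that avoid \<open>i\<close>.\<close>
  define r where "r = (\<lambda>(a, b). to_fract (Tq i (Var a - Var b)) / (xvar a - xvar b))"
  have "to_fract (Tq i (vandermonde n)) / to_fract (vandermonde n) = (\<Prod>p\<in>?S. r p)"
    by (simp add: vandermonde_def r_def ring_map_prod[OF ring_map_Tq] ring_map_prod[OF ring_map_to_fract]
        case_prod_unfold flip: prod_dividef)
  also have "\<dots> = (\<Prod>p\<in>?pair ` ({1..n} - {i}). r p)"
  proof (rule prod.mono_neutral_right[OF finite_vandermonde_pairs])
    show "?pair ` ({1..n} - {i}) \<subseteq> ?S"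
      using assms by (auto simp: min_def max_def)
    show "\<forall>p\<in>?S - ?pair ` ({1..n} - {i}). r p = 1"
    proof
      fix p assume p: "p \<in> ?S - ?pair ` ({1..n} - {i})"
      obtain a b where [simp]: "p = (a, b)" by force
      have "a \<noteq> i"
      proof
        assume "a = i"
        with p have "p = ?pair b" "b \<in> {1..n} - {i}" by auto
        with p show False by blast
      qed
      moreover have "b \<noteq> i"
      proof
        assume "b = i"
        with p have "p = ?pair a" "a \<in> {1..n} - {i}" by auto
        with p show False by blast
      qed
      ultimately show "r p = 1"
        using p by (simp add: r_def ring_map_diff[OF ring_map_Tq] Tq_Var Var_eq_iff)
    qed
  qed
  also have "\<dots> = (\<Prod>j\<in>{1..n} - {i}. r (?pair j))"
    by (subst prod.reindex) (auto simp: inj_on_def min_def max_def split: if_splits)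
  also have "\<dots> = shift_factor n i"
    unfolding shift_factor_def
  proof (rule prod.cong)
    fix j assume j: "j \<in> {1..n} - {i}"
    consider "i < j" | "j < i" using j by fastforce
    then show "r (?pair j) = (scal qq * xvar i - xvar j) / (xvar i - xvar j)"
    proof cases
      case 2
      then have "r (?pair j) = (xvar j - scal qq * xvar i) / (xvar j - xvar i)"
        by (simp add: r_def ring_map_diff[OF ring_map_Tq] Tq_Var scal_def)
      also have "\<dots> = (scal qq * xvar i - xvar j) / (xvar i - xvar j)"
        by (metis minus_diff_eq minus_divide_divide)
      finally show ?thesis .
    qed (simp add: r_def ring_map_diff[OF ring_map_Tq] Tq_Var scal_def)
  qed simp
  finally show ?thesis
    using vandermonde_nonzero[of n] by (simp add: field_simps)
qed

text \<open>The shift is multiplicative: the Vandermonde product yields \<open>shift_factor\<close>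
  and cancels against the denominator, while \<open>x_i^v\<close> yields
  \<open>q^v x_i^v\<close>.\<close>

lemma R_eq_sum:
  "R n v P = scal qq ^ v * (\<Sum>i=1..n. shift_factor n i * xvar i ^ v * to_fract (Tq i P))"
proof -
  have "to_fract (Tq i (Var i ^ v * vandermonde n * P)) / to_fract (vandermonde n)
      = scal qq ^ v * (shift_factor n i * xvar i ^ v * to_fract (Tq i P))" if "i \<in> {1..n}" for i
    using vandermonde_nonzero[of n]
    by (simp add: ring_map_mult[OF ring_map_Tq] ring_map_power[OF ring_map_Tq] Tq_Var
        Tq_vandermonde[OF that] ring_map_power[OF ring_map_to_fract] power_mult_distrib scal_def mult_ac)
  then show ?thesis
    by (simp add: R_def ring_map_sum[OF ring_map_to_fract] sum_divide_distrib sum_distrib_left)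
qed

section \<open>Partial fractions of the Cauchy kernel\<close>

text \<open>Multiplied by the product of the \<open>w - a i\<close>, both sides become polynomials
  in \<open>w\<close> of degree at most \<open>card I\<close>; they agree at 0 and at every
  \<open>a i\<close>, hence everywhere.\<close>

lemma partial_fractions:
  fixes a :: "'i \<Rightarrow> 'a::field"
  assumes fin: "finite I" and inj: "inj_on a I" and nz: "\<And>i. i \<in> I \<Longrightarrow> a i \<noteq> 0"
    and w: "\<And>i. i \<in> I \<Longrightarrow> w \<noteq> a i"
  shows "(\<Prod>i\<in>I. (q * w - a i) / (w - a i))
    = 1 + (q - 1) * (\<Sum>i\<in>I. (\<Prod>j\<in>I - {i}. (q * a i - a j) / (a i - a j)) * (w / (w - a i)))"
proof -
  define A where "A i = (\<Prod>j\<in>I - {i}. (q * a i - a j) / (a i - a j))" for i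
  \<comment> \<open>\<open>L\<close> and \<open>M\<close> are the two sides with denominators
    cleared, as polynomials in \<open>w\<close>.\<close>
  define L where "L = (\<Prod>i\<in>I. [:- a i, q:])"
  define M where "M = (\<Prod>i\<in>I. [:- a i, 1:])
    + (\<Sum>i\<in>I. smult ((q - 1) * A i) ([:0, 1:] * (\<Prod>j\<in>I - {i}. [:- a j, 1:])))"
  have deg: "degree (\<Prod>i\<in>J. [:- a i, c:]) \<le> card J" for c J
    using degree_prod_sum_le[of J "\<lambda>i. [:- a i, c:]"] sum_bounded_above[of J "\<lambda>i. degree [:- a i, c:]" 1]
    by (cases "finite J"; cases "c = 0") auto
  have "degree (smult ((q - 1) * A i) ([:0, 1:] * (\<Prod>j\<in>I - {i}. [:- a j, 1:]))) \<le> card I"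
    if "i \<in> I" for i
  proof -
    have "degree ([:0, 1:] * (\<Prod>j\<in>I - {i}. [:- a j, 1:])) \<le> 1 + card (I - {i})"
      using degree_mult_le[of "[:0, 1:]" "\<Prod>j\<in>I - {i}. [:- a j, 1:]"] deg[where J = "I - {i}" and c = 1]
      by (simp del: mult_pCons_left)
    also have "1 + card (I - {i}) = card I"
      using card_Suc_Diff1[OF fin that] by linarith
    finally show ?thesis
      using degree_smult_le order_trans by blast
  qed
  then have "degree M \<le> card I"
    unfolding M_def using fin deg by (intro degree_add_le degree_sum_le)
  moreover have "degree L \<le> card I"
    unfolding L_def by (rule deg)
  \<comment> \<open>One node more than the degree bound, because the \<open>a i\<close> are distinct
    and nonzero.\<close>
  moreover have "card (insert 0 (a ` I)) = Suc (card I)"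
    using fin nz inj by (subst card_insert_disjoint) (auto simp: card_image)
  moreover have "poly L x = poly M x" if x: "x \<in> insert 0 (a ` I)" for x
  proof (cases "x = 0")
    \<comment> \<open>At 0 the sum drops out by its factor \<open>[:0, 1:]\<close>, and both
      products become that of the \<open>- a i\<close>.\<close>
    case True
    then show ?thesis by (simp add: L_def M_def poly_prod poly_sum)
  next
    case False
    then obtain k where k: "k \<in> I" "x = a k" using x by auto
    \<comment> \<open>At \<open>a k\<close> every summand other than the one of index
      \<open>k\<close> contains the factor \<open>a k - a k\<close>, as does the leading product of
      \<open>M\<close>.\<close>
    have "(\<Prod>j\<in>I - {i}. a k - a j) = 0" if "i \<in> I - {k}" for i
      using that k fin by (intro prod_zero) auto
    then have "(\<Sum>i\<in>I - {k}. (q - 1) * A i * (a k * (\<Prod>j\<in>I - {i}. a k - a j))) = 0"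
      by (intro sum.neutral) simp
    then have "poly M x = (q - 1) * (A k * (a k * (\<Prod>j\<in>I - {k}. a k - a j)))"
      using fin k by (simp add: M_def poly_prod poly_sum sum.remove[of I k] prod.remove[of I k] mult_ac)
    also have "A k * (a k * (\<Prod>j\<in>I - {k}. a k - a j)) = a k * (\<Prod>j\<in>I - {k}. q * a k - a j)"
    proof -
      have "(\<Prod>j\<in>I - {k}. a k - a j) \<noteq> 0"
        using fin k inj by (auto simp: inj_on_def)
      then show ?thesis by (simp add: A_def prod_dividef)
    qed
    \<comment> \<open>The factor of \<open>L\<close> at index \<open>k\<close> is
      \<open>q * a k - a k\<close>, which supplies \<open>(q - 1) * a k\<close>.\<close>
    also have "(q - 1) * (a k * (\<Prod>j\<in>I - {k}. q * a k - a j)) = poly L x"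
      using fin k by (simp add: L_def poly_prod prod.remove[of I k] algebra_simps)
    finally show ?thesis ..
  qed
  ultimately have "L = M"
    by (intro poly_eqI_degree[of "insert 0 (a ` I)"]) simp_all
  moreover have "poly L w = (\<Prod>i\<in>I. q * w - a i)"
    by (simp add: L_def poly_prod mult.commute)
  moreover have "poly M w = (\<Prod>i\<in>I. w - a i)
      + (\<Sum>i\<in>I. (q - 1) * A i * (w * (\<Prod>j\<in>I - {i}. w - a j)))"
    by (simp add: M_def poly_prod poly_sum mult_ac)
  ultimately have "(\<Prod>i\<in>I. q * w - a i) = (\<Prod>i\<in>I. w - a i)
      + (\<Sum>i\<in>I. (q - 1) * A i * (w * (\<Prod>j\<in>I - {i}. w - a j)))"
    by simp
  then have "(\<Prod>i\<in>I. (q * w - a i) / (w - a i)) = ((\<Prod>i\<in>I. w - a i)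
      + (\<Sum>i\<in>I. (q - 1) * A i * (w * (\<Prod>j\<in>I - {i}. w - a j)))) / (\<Prod>i\<in>I. w - a i)"
    by (simp add: prod_dividef)
  also have "\<dots> = 1 + (\<Sum>i\<in>I. (q - 1) * A i * (w * (\<Prod>j\<in>I - {i}. w - a j)) / (\<Prod>i\<in>I. w - a i))"
    using fin w by (simp add: add_divide_distrib sum_divide_distrib)
  also have "(\<Sum>i\<in>I. (q - 1) * A i * (w * (\<Prod>j\<in>I - {i}. w - a j)) / (\<Prod>i\<in>I. w - a i))
      = (\<Sum>i\<in>I. (q - 1) * (A i * (w / (w - a i))))"
  proof (rule sum.cong)
    fix i assume i: "i \<in> I"
    have "(\<Prod>j\<in>I - {i}. w - a j) \<noteq> 0" using fin w by auto
    then show "(q - 1) * A i * (w * (\<Prod>j\<in>I - {i}. w - a j)) / (\<Prod>i\<in>I. w - a i)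
        = (q - 1) * (A i * (w / (w - a i)))"
      using fin i by (simp add: prod.remove[of I i])
  qed simp
  finally show ?thesis by (simp add: A_def sum_distrib_left)
qed

section \<open>Expansion of the partial fractions in powers of z\<close>

lemma fls_geometric:
  fixes c :: "'a::field"
  shows "1 / (1 - fls_const c * fls_X) = fps_to_fls (Abs_fps (\<lambda>n. c ^ n))"
proof -
  have "(1 - fps_const c * fps_X) * Abs_fps (\<lambda>n. c ^ n) = 1"
  proof (rule fps_ext)
    fix n show "((1 - fps_const c * fps_X) * Abs_fps (\<lambda>n. c ^ n)) $ n = 1 $ n"
      by (cases n) (simp_all add: left_diff_distrib mult.assoc)
  qed
  then have "fps_to_fls ((1 - fps_const c * fps_X) * Abs_fps (\<lambda>n. c ^ n)) = 1" by simp
  then have "(1 - fls_const c * fls_X) * fps_to_fls (Abs_fps (\<lambda>n. c ^ n)) = 1"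
    by (simp add: fls_times_fps_to_fls fps_to_fls_minus)
  then show ?thesis
    by (metis divide_eq_eq mult.commute mult_zero_left zero_neq_one)
qed

text \<open>\<open>partial_fractions\<close> is applied in the field of Laurent series with
  \<open>w = 1/z\<close> and \<open>a i = x_i\<close>; the power \<open>q^n\<close> supplies one
  \<open>q\<close> to each factor of \<open>Omega\<close>.\<close>

lemma Omega_nth:
  "scal qq ^ n * fls_nth (Omega n) (int r)
    = (if r = 0 then 1 else 0) + (scal qq - 1) * (\<Sum>i=1..n. shift_factor n i * xvar i ^ r)"
proof -
  let ?q = "fls_const (scal qq)" and ?x = "\<lambda>i. fls_const (xvar i)"
  have sq: "scal qq * scal (inverse qq) = 1"
    using qq_nonzero by (simp add: ring_map_1[OF ring_map_scal] flip: ring_map_mult[OF ring_map_scal])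
  \<comment> \<open>\<open>1/z\<close> has a term of degree -1, so it differs from every constant,
    as \<open>partial_fractions\<close> requires of \<open>w\<close>.\<close>
  have w: "fls_X_inv \<noteq> fls_const c" for c :: qfrac
  proof
    assume "fls_X_inv = fls_const c"
    then have "fls_nth fls_X_inv (- 1) = fls_nth (fls_const c) (- 1)" by simp
    then show False by simp
  qed
  have inj: "fls_const c = fls_const d \<longleftrightarrow> c = d" for c d :: qfrac
    by (metis fls_const_nth)
  \<comment> \<open>Multiplying numerator and denominator by \<open>1/z\<close> turns factors linear
    in \<open>z\<close> into factors linear in \<open>1/z\<close>.\<close>
  have div: "(fls_X_inv * y - c) / (fls_X_inv * z - d) = (y - c * fls_X) / (z - d * fls_X)"
    for y z c d :: "qfrac fls"
  proof -
    have X: "fls_X * fls_X_inv = (1 :: qfrac fls)"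
      by (simp flip: fls_inverse_X)
    have "(y - c * fls_X) / (z - d * fls_X)
        = ((y - c * fls_X) * fls_X_inv) / ((z - d * fls_X) * fls_X_inv)"
      by simp
    then show ?thesis
      by (simp add: left_diff_distrib mult.assoc X mult.commute[of fls_X_inv])
  qed
  have "?q ^ n * Omega n = (\<Prod>i=1..n. (?q * fls_X_inv - ?x i) / (fls_X_inv - ?x i))"
  proof -
    have "?q * ((1 - fls_const (scal (inverse qq) * xvar i) * fls_X) / (1 - ?x i * fls_X))
        = (?q * fls_X_inv - ?x i) / (fls_X_inv - ?x i)" for i
    proof -
      have "?q * fls_const (scal (inverse qq) * xvar i) = ?x i"
        by (simp add: sq flip: mult.assoc)
      then show ?thesis
        using div[of ?q "?x i" 1 "?x i"]
        by (simp add: right_diff_distrib mult.commute[of fls_X_inv] flip: mult.assoc)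
    qed
    moreover have "?q ^ n = (\<Prod>i=1..n. ?q)" by simp
    ultimately show ?thesis
      unfolding Omega_def by (simp only: flip: prod.distrib)
  qed
  also have "\<dots> = 1 + (?q - 1) * (\<Sum>i=1..n. (\<Prod>j\<in>{1..n} - {i}. (?q * ?x i - ?x j) / (?x i - ?x j))
      * (fls_X_inv / (fls_X_inv - ?x i)))"
    using w by (intro partial_fractions) (auto simp: inj_on_def inj Var_eq_iff Var_nonzero fls_const_nonzero)
  also have "\<dots> = 1 + fls_const (scal qq - 1) * (\<Sum>i=1..n. fls_const (shift_factor n i)
      * fps_to_fls (Abs_fps (\<lambda>r. xvar i ^ r)))"
    \<comment> \<open>With \<open>c = 0\<close> this turns \<open>w / (w - x_i)\<close> into
      \<open>1 / (1 - x_i z)\<close>, a geometric series.\<close>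
    using div[of 1 0 1 "?x _"]
    by (simp add: shift_factor_def ring_map_prod[OF ring_map_fls_const] ring_map_diff[OF ring_map_fls_const]
        fls_geometric flip: fls_const_divide_const)
  finally have "fls_nth (fls_const (scal qq ^ n) * Omega n) (int r)
      = fls_nth (1 + fls_const (scal qq - 1) * (\<Sum>i=1..n. fls_const (shift_factor n i)
        * fps_to_fls (Abs_fps (\<lambda>r. xvar i ^ r)))) (int r)"
    by (simp add: ring_map_power[OF ring_map_fls_const])
  then show ?thesis
    by (simp add: fls_nth_sum fls_mult_const_nth)
qed

section \<open>The plethystic substitution as a polynomial in the inverse of z\<close>

lemma ring_map_map_poly:
  assumes "ring_map h"
  shows "ring_map (map_poly h)"
  using ring_map_0[OF assms] ring_map_1[OF assms]
  by (intro ring_mapI poly_eqI)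
    (simp_all add: coeff_map_poly coeff_mult ring_map_add[OF assms] ring_map_mult[OF assms]
      ring_map_sum[OF assms])

lemma ring_map_poly: "ring_map (\<lambda>p. poly p y)"
  by (rule ring_mapI) simp_all

text \<open>The plethysm with \<open>1/z\<close> kept as a polynomial variable, so that it can be
  specialised both to \<open>x_i\<close> and to \<open>fls_X_inv\<close>.\<close>

definition pleth_poly :: "nat \<Rightarrow> qpoly \<Rightarrow> qfrac poly" where
  "pleth_poly n F = ev (\<lambda>a. [:scal a:])
     (\<lambda>k. [:to_fract (power_sum n k):] - monom (scal (1 - qq ^ k)) k) F"

lemma poly_pleth_poly:
  "poly (pleth_poly n F) y = ev scal (\<lambda>k. to_fract (power_sum n k) - scal (1 - qq ^ k) * y ^ k) F"
  unfolding pleth_poly_def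
  by (subst ring_map_comp_ev[OF ring_map_poly]) (simp add: poly_monom)

lemma pleth_eq_pleth_poly:
  "pleth n F = (\<Sum>m\<le>degree (pleth_poly n F). fls_const (coeff (pleth_poly n F) m) * fls_X_inv ^ m)"
proof -
  let ?h = "\<lambda>p. poly (map_poly fls_const p) fls_X_inv :: qfrac fls"
  have "ring_map ?h"
    by (intro ring_map_comp[OF ring_map_poly] ring_map_map_poly ring_map_fls_const)
  note h = ring_map_comp_ev[OF this] ring_map_diff[OF this]
  have "?h (pleth_poly n F) = pleth n F"
    unfolding pleth_def pleth_poly_def h by (simp add: map_poly_pCons map_poly_monom poly_monom)
  \<comment> \<open>\<open>fls_const\<close> sends no nonzero coefficient to 0, so the embedding
    keeps the degree.\<close>
  moreover have "degree (map_poly fls_const p) = degree p" for p :: "qfrac poly"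
    by (cases "p = 0") (simp_all add: map_poly_degree_eq)
  ultimately show ?thesis
    by (simp add: poly_altdef coeff_map_poly)
qed

text \<open>Only the summand of index \<open>i\<close> changes, from \<open>x_i^k\<close> to
  \<open>q^k x_i^k\<close>.\<close>

lemma Tq_power_sum:
  assumes "i \<in> {1..n}"
  shows "to_fract (Tq i (power_sum n k)) = to_fract (power_sum n k) - scal (1 - qq ^ k) * xvar i ^ k"
proof -
  have "to_fract (Tq i (power_sum n k)) = (\<Sum>j=1..n. to_fract (Tq i (Var j)) ^ k)"
    by (simp add: power_sum_def ring_map_sum[OF ring_map_Tq] ring_map_power[OF ring_map_Tq]
        ring_map_sum[OF ring_map_to_fract] ring_map_power[OF ring_map_to_fract])
  also have "\<dots> = (\<Sum>j=1..n. xvar j ^ k - (if j = i then scal (1 - qq ^ k) * xvar i ^ k else 0))"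
    by (intro sum.cong) (auto simp: Tq_Var scal_def[symmetric] power_mult_distrib left_diff_distrib
        ring_map_diff[OF ring_map_scal] ring_map_1[OF ring_map_scal] ring_map_power[OF ring_map_scal])
  also have "\<dots> = to_fract (power_sum n k) - scal (1 - qq ^ k) * xvar i ^ k"
    using assms by (simp add: sum_subtractf power_sum_def ring_map_sum[OF ring_map_to_fract]
        ring_map_power[OF ring_map_to_fract])
  finally show ?thesis .
qed

text \<open>Both sides substitute the same values into \<open>F\<close>: the shifted power sums are
  the plethystic ones at \<open>1/z = x_i\<close>.\<close>

lemma pleth_poly_at_xvar:
  assumes "power_sum_expression n F P" "i \<in> {1..n}"
  shows "poly (pleth_poly n F) (xvar i) = to_fract (Tq i P)"
proof -
  have "to_fract (Tq i P) = to_fract (Tq i (ev Const (power_sum n) F))"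
    using assms(1) by (simp add: power_sum_expression_def)
  also have "\<dots> = ev scal (\<lambda>k. to_fract (Tq i (power_sum n k))) F"
    by (simp add: ring_map_comp_ev[OF ring_map_Tq] ring_map_comp_ev[OF ring_map_to_fract] Tq_Const
        flip: scal_def)
  finally show ?thesis
    by (simp add: poly_pleth_poly Tq_power_sum[OF assms(2)])
qed

text \<open>The constant coefficient is the value at \<open>1/z = 0\<close>, where the correction to
  each power sum of positive index vanishes.\<close>

lemma coeff_0_pleth_poly:
  assumes "power_sum_expression n F P"
  shows "coeff (pleth_poly n F) 0 = to_fract P"
proof -
  have F: "P = ev Const (power_sum n) F" "vars F \<subseteq> {1..}"
    using assms by (simp_all add: power_sum_expression_def)
  have "coeff (pleth_poly n F) 0 = ev scal (\<lambda>k. to_fract (power_sum n k) - scal (1 - qq ^ k) * 0 ^ k) F"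
    by (simp flip: poly_0_coeff_0 add: poly_pleth_poly)
  also have "\<dots> = ev scal (\<lambda>k. to_fract (power_sum n k)) F"
    using F(2) by (intro ev_cong) auto
  finally show ?thesis
    by (simp add: F(1) ring_map_comp_ev[OF ring_map_to_fract] flip: scal_def)
qed

text \<open>Existence makes the second claim non-vacuous; since that claim holds for every
  \<open>F\<close>, the right-hand side does not depend on the choice of \<open>F\<close>.\<close>

theorem theorem4p1:
  fixes n v :: nat and P :: qpoly
  assumes "symmetric_poly n P"
  shows "(\<exists>F. power_sum_expression n F P) \<and>
    (\<forall>F. power_sum_expression n F P \<longrightarrow>
      R n v P = scal ((if v = 0 then 1 else 0) / (1 - qq)) * to_fract P
                + scal (qq ^ (n + v) / (qq - 1)) * fls_nth (pleth n F * Omega n) (int v))"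
proof (intro conjI allI impI)
  show "\<exists>F. power_sum_expression n F P"
    using assms by (rule symmetric_poly_power_sum_expression)
  fix F assume F: "power_sum_expression n F P"
  define H where "H = pleth_poly n F"
  define S where "S r = (\<Sum>i=1..n. shift_factor n i * xvar i ^ r)" for r
  define q where "q = scal qq"
  define d :: qfrac where "d = (if v = 0 then 1 else 0)"
  have q1: "q - 1 = scal (qq - 1)"
    by (simp add: q_def ring_map_diff[OF ring_map_scal] ring_map_1[OF ring_map_scal])
  then have q1_nz: "q - 1 \<noteq> 0"
    using qq_neq_1 by (simp add: scal_eq_0_iff)
  have c1: "scal (qq ^ (n + v) / (qq - 1)) = q ^ n * q ^ v / (q - 1)"
    by (simp add: scal_divide power_add ring_map_power[OF ring_map_scal] ring_map_mult[OF ring_map_scal]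
        flip: q1 q_def)
  have "scal (1 - qq) = - (q - 1)"
    by (simp add: q1 flip: ring_map_minus[OF ring_map_scal])
  then have "scal ((if v = 0 then 1 else 0) / (1 - qq)) = d / - (q - 1)"
    by (simp add: scal_divide d_def ring_map_0[OF ring_map_scal] ring_map_1[OF ring_map_scal])
  also have "\<dots> = - (d / (q - 1))"
    by (rule minus_divide_right[symmetric])
  finally have c2: "scal ((if v = 0 then 1 else 0) / (1 - qq)) = - (d / (q - 1))" .
  have "R n v P = q ^ v * (\<Sum>i=1..n. shift_factor n i * xvar i ^ v * poly H (xvar i))"
    by (simp add: R_eq_sum q_def H_def pleth_poly_at_xvar[OF F])
  also have "(\<Sum>i=1..n. shift_factor n i * xvar i ^ v * poly H (xvar i))
      = (\<Sum>m\<le>degree H. coeff H m * S (v + m))"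
    by (simp add: poly_altdef S_def sum_distrib_left sum.swap[of _ "{..degree H}"] power_add mult_ac)
  finally have lhs: "R n v P = q ^ v * (\<Sum>m\<le>degree H. coeff H m * S (v + m))" .
  \<comment> \<open>For natural numbers \<open>v + m = 0\<close> forces \<open>v = m = 0\<close>, so
    the constant 1 in \<open>Omega_nth\<close> meets only the coefficient of \<open>H\<close> at
    0.\<close>
  have const: "(\<Sum>m\<le>degree H. coeff H m * (if v + m = 0 then 1 else 0)) = d * coeff H 0"
    by (cases "v = 0") (simp_all add: d_def if_distrib cong: if_cong)
  \<comment> \<open>Multiplication by \<open>z^-m\<close> moves the coefficient of
    \<open>z^(v+m)\<close> to \<open>z^v\<close>, so \<open>Omega\<close> is read off only at
    nonnegative degrees, where \<open>Omega_nth\<close> applies.\<close>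
  have "fls_nth (pleth n F * Omega n) (int v) = (\<Sum>m\<le>degree H. coeff H m * fls_nth (Omega n) (int (v + m)))"
    by (simp add: pleth_eq_pleth_poly H_def sum_distrib_right fls_nth_sum mult.assoc
        fls_X_inv_power_times_conv_shift(1))
  then have "q ^ n * fls_nth (pleth n F * Omega n) (int v)
      = (\<Sum>m\<le>degree H. coeff H m * (q ^ n * fls_nth (Omega n) (int (v + m))))"
    by (simp add: sum_distrib_left mult_ac)
  also have "\<dots> = (\<Sum>m\<le>degree H. coeff H m * (if v + m = 0 then 1 else 0) + (q - 1) * (coeff H m * S (v + m)))"
    unfolding Omega_nth q_def S_def by (simp add: algebra_simps)
  also have "\<dots> = d * coeff H 0 + (q - 1) * (\<Sum>m\<le>degree H. coeff H m * S (v + m))"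
    by (simp only: sum.distrib const flip: sum_distrib_left)
  finally have "q ^ n * fls_nth (pleth n F * Omega n) (int v)
      = d * to_fract P + (q - 1) * (\<Sum>m\<le>degree H. coeff H m * S (v + m))"
    by (simp add: H_def coeff_0_pleth_poly[OF F])
  then have "q ^ n * q ^ v / (q - 1) * fls_nth (pleth n F * Omega n) (int v)
      = q ^ v / (q - 1) * (d * to_fract P + (q - 1) * (\<Sum>m\<le>degree H. coeff H m * S (v + m)))"
    by (simp add: mult_ac)
  also have "\<dots> = q ^ v * d / (q - 1) * to_fract P + R n v P"
    using q1_nz by (simp add: lhs distrib_left)
  \<comment> \<open>\<open>d\<close> is nonzero only for \<open>v = 0\<close>, where
    \<open>q ^ v = 1\<close>. The resulting term then cancels against the one with
    \<open>1 / (1 - qq)\<close>, which has the opposite sign.\<close>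
  also have "q ^ v * d = d"
    by (simp add: d_def)
  finally show "R n v P = scal ((if v = 0 then 1 else 0) / (1 - qq)) * to_fract P
      + scal (qq ^ (n + v) / (qq - 1)) * fls_nth (pleth n F * Omega n) (int v)"
    unfolding c1 c2 by simp
qed

end
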